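(* Let $P$ be a finite graded poset with $\hat0$ and $\hat1$. The following conditions are equivalent: (a) The flag $h$-vector $\beta_P$ is multiplicity-free. (b) $P$ has at most two elements of each rank.
   Context: For a finite graded poset $P$ of rank $n$ with $\hat0,\hat1$ and rank function $\rho$, the flag $f$-vector is $\alpha_P(S)=$ number of chains $C$ of $P$ with $\{\rho(t):t\in C\}=S$, for $S\subseteq[n-1]$, and the flag $h$-vector is $\beta_P(S)=\sum_{T\subseteq S}(-1)^{\#(S-T)}\alpha_P(T)$. $\beta_P$ is multiplicity-free if $\beta_P(S)\in\{0,1,-1\}$ for all $S\subseteq[n-1]$. *)

theory Defs
  imports Main
begin

(* A poset is a carrier set P together with its weak order relation r, i.e. partial_order_on P r.
   Since then r is contained in P x P, the elements of Chains r are exactly the chains of P,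
   the empty chain included. *)

definition maximal_chains :: "('a \<times> 'a) set \<Rightarrow> 'a set set" where
  "maximal_chains r = {C \<in> Chains r. \<forall>D \<in> Chains r. C \<subseteq> D \<longrightarrow> D = C}"

(* A chain of length n has n + 1 elements. *)
definition finite_graded_poset :: "'a set \<Rightarrow> ('a \<times> 'a) set \<Rightarrow> nat \<Rightarrow> bool" where
  "finite_graded_poset P r n \<longleftrightarrow>
     finite P \<and> partial_order_on P r \<and> (\<forall>C \<in> maximal_chains r. card C = n + 1)"

definition has_bot_top :: "'a set \<Rightarrow> ('a \<times> 'a) set \<Rightarrow> bool" where
  "has_bot_top P r \<longleftrightarrow>
     (\<exists>z \<in> P. \<forall>t \<in> P. (z, t) \<in> r) \<and> (\<exists>u \<in> P. \<forall>t \<in> P. (t, u) \<in> r)"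

definition covers :: "('a \<times> 'a) set \<Rightarrow> 'a \<Rightarrow> 'a \<Rightarrow> bool" where
  "covers r t s \<longleftrightarrow>
     (s, t) \<in> r \<and> s \<noteq> t \<and> (\<forall>x. (s, x) \<in> r \<and> (x, t) \<in> r \<longrightarrow> x = s \<or> x = t)"

(* Values outside P are unconstrained; on P these conditions determine rho uniquely. *)
definition rank_function :: "'a set \<Rightarrow> ('a \<times> 'a) set \<Rightarrow> ('a \<Rightarrow> nat) \<Rightarrow> bool" where
  "rank_function P r \<rho> \<longleftrightarrow>
     (\<forall>s \<in> P. (\<forall>x. (x, s) \<in> r \<longrightarrow> x = s) \<longrightarrow> \<rho> s = 0) \<and>
     (\<forall>s \<in> P. \<forall>t \<in> P. covers r t s \<longrightarrow> \<rho> t = \<rho> s + 1)"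

definition flag_f :: "('a \<times> 'a) set \<Rightarrow> ('a \<Rightarrow> nat) \<Rightarrow> nat set \<Rightarrow> nat" where
  "flag_f r \<rho> S = card {C \<in> Chains r. \<rho> ` C = S}"

definition flag_h :: "('a \<times> 'a) set \<Rightarrow> ('a \<Rightarrow> nat) \<Rightarrow> nat set \<Rightarrow> int" where
  "flag_h r \<rho> S = (\<Sum>T \<in> Pow S. (-1) ^ card (S - T) * int (flag_f r \<rho> T))"

(* {1..<n} is [n-1], also for n = 0. *)
definition multiplicity_free :: "nat \<Rightarrow> (nat set \<Rightarrow> int) \<Rightarrow> bool" where
  "multiplicity_free n b \<longleftrightarrow> (\<forall>S. S \<subseteq> {1..<n} \<longrightarrow> b S \<in> {0, 1, -1})"

lemma chain_extends_to_maximal: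
  assumes "finite P" "partial_order_on P r" "C \<in> Chains r"
  obtains D where "D \<in> maximal_chains r" "C \<subseteq> D"
proof -
  have sub: "Chains r \<subseteq> Pow P"
    using assms(2) by (auto simp: Chains_def partial_order_on_def preorder_on_def)
  let ?F = "{D \<in> Chains r. C \<subseteq> D}"
  have "finite ?F" using finite_subset[OF sub] assms(1) by auto
  moreover have "?F \<noteq> {}" using assms(3) by auto
  ultimately obtain D where D: "D \<in> ?F" "\<And>E. E \<in> ?F \<Longrightarrow> D \<subseteq> E \<Longrightarrow> D = E"
    using finite_has_maximal[of ?F] by metis
  have "D \<in> maximal_chains r"
    using D unfolding maximal_chains_def by blast
  then show thesis using that D(1) by blast
qed

lemma rank_function_exists:
  assumes gr: "finite_graded_poset P r n"
  shows "\<exists>\<rho>. rank_function P r \<rho>"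
proof -
  have fin: "finite P" and po: "partial_order_on P r"
    and mx: "\<And>C. C \<in> maximal_chains r \<Longrightarrow> card C = n + 1"
    using gr by (auto simp: finite_graded_poset_def)
  have sub: "\<And>C. C \<in> Chains r \<Longrightarrow> C \<subseteq> P" and rP: "r \<subseteq> P \<times> P"
    and rf: "\<And>x. x \<in> P \<Longrightarrow> (x, x) \<in> r"
    and tr: "\<And>x y z. (x, y) \<in> r \<Longrightarrow> (y, z) \<in> r \<Longrightarrow> (x, z) \<in> r"
    and as: "\<And>x y. (x, y) \<in> r \<Longrightarrow> (y, x) \<in> r \<Longrightarrow> x = y"
    using po by (auto simp: Chains_def partial_order_on_def preorder_on_def refl_on_def
        dest: transD antisymD)
  have finC: "finite C" if "C \<in> Chains r" for C
    using sub[OF that] fin finite_subset by blast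
  have finCh: "finite (Chains r)"
    using sub fin by (metis PowI finite_Pow_iff finite_subset subsetI)
  define B where "B t = {C \<in> Chains r. \<forall>x \<in> C. (x, t) \<in> r \<and> x \<noteq> t}" for t
  define h where "h t = Max (card ` B t)" for t
  have finB: "finite (B t)" for t using finCh by (auto simp: B_def)
  have neB: "{} \<in> B t" for t by (auto simp: B_def Chains_def)
  have h_ge: "card C \<le> h t" if "C \<in> B t" for C t
    unfolding h_def using that finB by simp
  have h_at: "\<exists>C \<in> B t. card C = h t" for t
    using Max_in[of "card ` B t"] finB neB unfolding h_def by fastforce
  have "h s = 0" if "s \<in> P" "\<forall>x. (x, s) \<in> r \<longrightarrow> x = s" for s
  proof -
    have "B s = {{}}" using that neB by (auto simp: B_def)
    then show ?thesis by (simp add: h_def)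
  qed
  moreover have "h t = h s + 1" if sP: "s \<in> P" and tP: "t \<in> P" and cov: "covers r t s" for s t
  proof (rule antisym)
    have st: "(s, t) \<in> r" "s \<noteq> t" and btw: "\<And>x. (s, x) \<in> r \<Longrightarrow> (x, t) \<in> r \<Longrightarrow> x = s \<or> x = t"
      using cov by (auto simp: covers_def)
    obtain C where C: "C \<in> B s" "card C = h s" using h_at by blast
    have Cs: "C \<in> Chains r" "\<And>x. x \<in> C \<Longrightarrow> (x, s) \<in> r \<and> x \<noteq> s"
      using C by (auto simp: B_def)
    have "insert s C \<in> Chains r" using Cs rf[OF sP] by (auto simp: Chains_def)
    then have "insert s C \<in> B t"
      using Cs st as tr unfolding B_def by blast
    from h_ge[OF this] show "h s + 1 \<le> h t"
      using C(2) finC[OF Cs(1)] Cs(2) by (metis Suc_eq_plus1 card_insert_disjoint)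
    define U where "U = {D \<in> Chains r. t \<in> D \<and> (\<forall>x \<in> D. (t, x) \<in> r)}"
    have "finite U" using finCh by (auto simp: U_def)
    moreover have "{t} \<in> U" using rf[OF tP] by (auto simp: U_def Chains_def)
    ultimately obtain D where D: "D \<in> U" "\<And>E. E \<in> U \<Longrightarrow> D \<subseteq> E \<Longrightarrow> D = E"
      using finite_has_maximal[of U] by (metis empty_iff)
    have Ds: "D \<in> Chains r" "t \<in> D" "\<And>x. x \<in> D \<Longrightarrow> (t, x) \<in> r"
      using D by (auto simp: U_def)
    define M where "M = insert s C \<union> D"
    have Mch: "M \<in> Chains r"
    proof -
      have "(x, y) \<in> r" if "x \<in> insert s C" "y \<in> D" for x y
        using that Cs(2) Ds(3) st tr by blast
      then show ?thesis
        using \<open>insert s C \<in> Chains r\<close> Ds(1) unfolding M_def Chains_def by blast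
    qed
    have "M \<in> maximal_chains r"
      unfolding maximal_chains_def
    proof (intro CollectI conjI Mch ballI impI)
      fix E assume E: "E \<in> Chains r" "M \<subseteq> E"
      have cmp: "\<And>x y. x \<in> E \<Longrightarrow> y \<in> E \<Longrightarrow> (x, y) \<in> r \<or> (y, x) \<in> r"
        using E(1) by (auto simp: Chains_def)
      have sE: "s \<in> E" and tE: "t \<in> E" using E(2) Ds(2) by (auto simp: M_def)
      have "x \<in> M" if xE: "x \<in> E" for x
      proof -
        consider "(t, x) \<in> r" | "(x, s) \<in> r" "x \<noteq> s" | "x = s"
          using cmp[OF xE sE] cmp[OF xE tE] btw[of x] rf[OF tP] by blast
        then show ?thesis
        proof cases
          case 1
          have "insert x D \<in> Chains r"
            using E xE unfolding Chains_def M_def by blast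
          then have "insert x D \<in> U" using Ds 1 by (auto simp: U_def)
          then show ?thesis using D(2) by (auto simp: M_def)
        next
          case 2
          have "insert x C \<in> Chains r"
            using E xE unfolding Chains_def M_def by blast
          then have "insert x C \<in> B s" using Cs 2 by (auto simp: B_def)
          then have "card (insert x C) \<le> card C" using h_ge C(2) by metis
          then have "x \<in> C" using finC[OF Cs(1)]
            by (metis card_insert_disjoint not_less_eq_eq order_refl)
          then show ?thesis by (simp add: M_def)
        qed (simp add: M_def)
      qed
      then show "E = M" using E(2) by blast
    qed
    then have "card M = n + 1" by (rule mx)
    moreover have "insert s C \<inter> D = {}" using Cs(2) Ds(3) st as tr by blast
    then have "card M = h s + 1 + card D"
      unfolding M_def using finC[OF Cs(1)] finC[OF Ds(1)] C(2) Cs(2)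
      by (metis Suc_eq_plus1 card_Un_disjoint card_insert_disjoint finite_insert)
    ultimately have n: "n + 1 = h s + 1 + card D" by simp
    obtain A where A: "A \<in> B t" "card A = h t" using h_at by blast
    have As: "A \<in> Chains r" "\<And>x. x \<in> A \<Longrightarrow> (x, t) \<in> r \<and> x \<noteq> t"
      using A by (auto simp: B_def)
    have "A \<union> D \<in> Chains r"
    proof -
      have "(x, y) \<in> r" if "x \<in> A" "y \<in> D" for x y
        using that As(2) Ds(3) tr by blast
      then show ?thesis using As(1) Ds(1) unfolding Chains_def by blast
    qed
    then obtain N where N: "N \<in> maximal_chains r" "A \<union> D \<subseteq> N"
      using chain_extends_to_maximal[OF fin po] by blast
    then have "card (A \<union> D) \<le> n + 1"
      using mx[OF N(1)] finC card_mono by (metis (no_types, lifting) maximal_chains_def mem_Collect_eq)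
    moreover have "A \<inter> D = {}" using As(2) Ds(3) as by blast
    then have "card (A \<union> D) = h t + card D"
      using finC[OF As(1)] finC[OF Ds(1)] A(2) by (simp add: card_Un_disjoint)
    ultimately show "h t \<le> h s + 1" using n by linarith
  qed
  ultimately show ?thesis unfolding rank_function_def by blast
qed

end

theory Submission
  imports Defs
begin

text \<open>
  For (a) implies (b), the flag h-vector at a singleton \<open>{i}\<close> is the number of elements of rank
  \<open>i\<close> minus 1. For the converse, build up \<open>S\<close> by adding its ranks in increasing order, and compare
  \<open>\<beta>\<^sub>P(S)\<close> with the same alternating sum \<open>\<beta>\<^sub>x(S)\<close> over the chains below an element \<open>x\<close> whose rank
  exceeds \<open>S\<close>. If \<open>m\<close> is the largest rank in \<open>S\<close>, splitting the chains by their element of rank \<open>m\<close>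
  gives \<open>\<beta>\<^sub>x(S) = (\<Sum>y \<le> x, \<rho>(y) = m. \<beta>\<^sub>y(S - {m})) - \<beta>\<^sub>x(S - {m})\<close>. If \<open>x\<close> lies above exactly one
  element \<open>y\<close> of rank \<open>m\<close>, then everything of smaller rank below \<open>x\<close> is below \<open>y\<close>, so the two terms
  cancel; if it lies above all of them, then \<open>\<beta>\<^sub>x(S) = \<beta>\<^sub>P(S)\<close>. With at most two elements of each
  rank there is no other case, so \<open>\<beta>\<^sub>x(S)\<close> is 0 or \<open>\<beta>\<^sub>P(S)\<close>, and the recursion for \<open>P\<close> itself keeps
  \<open>\<beta>\<^sub>P(S)\<close> in \<open>{0, 1, -1}\<close>.
\<close>

section \<open>Posets with a rank function, and signed sums over their chains\<close>

locale ranked_poset =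
  fixes P :: "'a set" and r :: "('a \<times> 'a) set" and \<rho> :: "'a \<Rightarrow> nat"
  assumes finite_carrier: "finite P"
    and partial_order: "partial_order_on P r"
    and rank_function: "rank_function P r \<rho>"
begin

definition down :: "'a \<Rightarrow> 'a set" where
  "down x = {y. (y, x) \<in> r}"

text \<open>With \<open>Q = down x\<close> this is the \<beta> at \<open>x\<close> of the overview.
  Summing over chains rather than over rank sets allows an arbitrary \<open>Q\<close>, always with
  the ranks taken in the whole poset.\<close>

definition signed_chain_sum :: "'a set \<Rightarrow> nat set \<Rightarrow> int" where
  "signed_chain_sum Q S =
     (\<Sum>C | C \<in> Chains r \<and> C \<subseteq> Q \<and> \<rho> ` C \<subseteq> S. (-1) ^ card (S - \<rho> ` C))"

lemma in_carrier: "(x, y) \<in> r \<Longrightarrow> x \<in> P \<and> y \<in> P"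
  and refl_r: "x \<in> P \<Longrightarrow> (x, x) \<in> r"
  and trans_r: "(x, y) \<in> r \<Longrightarrow> (y, z) \<in> r \<Longrightarrow> (x, z) \<in> r"
  and antisym_r: "(x, y) \<in> r \<Longrightarrow> (y, x) \<in> r \<Longrightarrow> x = y"
  using partial_order
  by (auto simp: partial_order_on_def preorder_on_def refl_on_def dest: transD antisymD)

lemma down_subset: "down x \<subseteq> P"
  using in_carrier by (auto simp: down_def)

lemma Chains_subset: "C \<in> Chains r \<Longrightarrow> C \<subseteq> P"
  using in_carrier by (auto simp: Chains_def)

lemma finite_chain: "C \<in> Chains r \<Longrightarrow> finite C"
  using Chains_subset finite_carrier finite_subset by blast

lemma finite_Chains: "finite (Chains r)"
  using Chains_subset finite_carrier by (metis PowI finite_Pow_iff finite_subset subsetI)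

section \<open>From covers to ranks along intervals\<close>

text \<open>A minimal element of the interval from \<open>z\<close> to \<open>x\<close>, with
  \<open>z\<close> left out, covers \<open>z\<close>.\<close>

lemma exists_cover:
  assumes "(z, x) \<in> r" "z \<noteq> x"
  shows "\<exists>c. covers r c z \<and> (c, x) \<in> r"
proof -
  define W where "W = {w. (z, w) \<in> r \<and> z \<noteq> w \<and> (w, x) \<in> r}"
  have "finite W"
    using finite_subset[OF _ finite_carrier, of W] in_carrier by (auto simp: W_def)
  moreover have "x \<in> W"
    using assms refl_r in_carrier by (auto simp: W_def)
  \<comment> \<open>Going strictly down inside \<open>W\<close> shrinks the part of \<open>W\<close>
    below, so minimising its size gives a minimal element.\<close>
  ultimately obtain c where c: "c \<in> W" "\<And>w. w \<in> W \<Longrightarrow> card (down c \<inter> W) \<le> card (down w \<inter> W)"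
    using arg_min_if_finite(1)[of W "\<lambda>w. card (down w \<inter> W)"]
      arg_min_least[of W _ "\<lambda>w. card (down w \<inter> W)"] by (metis empty_iff)
  have "w = c" if "w \<in> W" "(w, c) \<in> r" for w
  proof (rule ccontr)
    assume "w \<noteq> c"
    then have "down w \<inter> W \<subset> down c \<inter> W"
      using that c(1) refl_r[of c] trans_r antisym_r in_carrier
      unfolding down_def by blast
    then have "card (down w \<inter> W) < card (down c \<inter> W)"
      using \<open>finite W\<close> by (intro psubset_card_mono) auto
    then show False using c(2)[OF that(1)] by simp
  qed
  then have "covers r c z"
    using c(1) trans_r unfolding covers_def W_def by blast
  then show ?thesis using c(1) by (auto simp: W_def)
qed

text \<open>Passing from \<open>z\<close> to a cover of \<open>z\<close> below \<open>x\<close>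
  strictly shrinks the up-set, so the ascent ends at \<open>x\<close>. This turns the rule for
  \<rho> on covers into statements about all comparable pairs.\<close>

lemma interval_induct [consumes 1, case_names refl step]:
  assumes "(z, x) \<in> r"
    and "Q x"
    and "\<And>z c. (z, x) \<in> r \<Longrightarrow> z \<noteq> x \<Longrightarrow> covers r c z \<Longrightarrow> \<rho> c = \<rho> z + 1 \<Longrightarrow> (c, x) \<in> r \<Longrightarrow> Q c \<Longrightarrow> Q z"
  shows "Q z"
  using assms(1)
proof (induction "card {w. (z, w) \<in> r}" arbitrary: z rule: less_induct)
  case less
  show ?case
  proof (cases "z = x")
    case True
    then show ?thesis using assms(2) by simp
  next
    case False
    then obtain c where c: "covers r c z" "(c, x) \<in> r"
      using exists_cover less.prems by blast
    have zc: "(z, c) \<in> r" "z \<noteq> c" using c by (auto simp: covers_def)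
    then have "{w. (c, w) \<in> r} \<subset> {w. (z, w) \<in> r}"
      using trans_r antisym_r refl_r in_carrier by blast
    moreover have "finite {w. (z, w) \<in> r}"
      using in_carrier by (intro finite_subset[OF _ finite_carrier]) auto
    ultimately have "card {w. (c, w) \<in> r} < card {w. (z, w) \<in> r}"
      by (simp add: psubset_card_mono)
    then have "Q c" using less.hyps c(2) by blast
    moreover have "\<rho> c = \<rho> z + 1"
      using rank_function c(1) zc(1) in_carrier by (auto simp: rank_function_def)
    ultimately show ?thesis using assms(3) less.prems False c by blast
  qed
qed

lemma rank_mono: "(z, x) \<in> r \<Longrightarrow> \<rho> z \<le> \<rho> x"
  by (induction rule: interval_induct) auto

lemma rank_strict_mono:
  assumes "(z, x) \<in> r" "z \<noteq> x"
  shows "\<rho> z < \<rho> x"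
proof -
  obtain c where c: "covers r c z" "(c, x) \<in> r"
    using exists_cover assms by blast
  then have "\<rho> c = \<rho> z + 1"
    using rank_function in_carrier by (auto simp: rank_function_def covers_def)
  then show ?thesis using rank_mono[OF c(2)] by simp
qed

text \<open>Climbing from \<open>z\<close> to \<open>x\<close> by covers raises the rank by exactly
  one each time, so no value is skipped.\<close>

lemma rank_interpolation:
  assumes "(z, x) \<in> r" "\<rho> z \<le> m" "m \<le> \<rho> x"
  shows "\<exists>y. \<rho> y = m \<and> (z, y) \<in> r \<and> (y, x) \<in> r"
  using assms
proof (induction rule: interval_induct)
  case refl
  then show ?case using assms(1) in_carrier refl_r by (metis le_antisym)
next
  case (step z c)
  show ?case
  proof (cases "\<rho> z = m")
    case True
    then show ?thesis using step.hyps(1) in_carrier refl_r by blast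
  next
    case False
    then obtain y where "\<rho> y = m" "(c, y) \<in> r" "(y, x) \<in> r"
      using step by auto
    then show ?thesis using step.hyps(3) trans_r by (auto simp: covers_def)
  qed
qed

text \<open>Descend from \<open>x\<close> one rank at a time. Applied to the top element, this
  compares its rank with the size of the maximal chains.\<close>

lemma exists_chain_of_rank:
  assumes "x \<in> P"
  shows "\<exists>C \<in> Chains r. C \<subseteq> down x \<and> card C = \<rho> x + 1"
  using assms
proof (induction "\<rho> x" arbitrary: x)
  case 0
  then show ?case
    by (intro bexI[of _ "{x}"]) (auto simp: Chains_def down_def refl_r)
next
  case (Suc k)
  \<comment> \<open>Minimal elements have rank 0, so an \<open>x\<close> of positive rank is not
    minimal.\<close>
  obtain z where z: "(z, x) \<in> r" "z \<noteq> x"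
    using rank_function Suc.hyps(2) Suc.prems by (force simp: rank_function_def)
  have "\<rho> z \<le> k" using rank_strict_mono[OF z] Suc.hyps(2) by simp
  then obtain y where y: "\<rho> y = k" "(y, x) \<in> r"
    using rank_interpolation[OF z(1), of k] Suc.hyps(2) by auto
  obtain C where C: "C \<in> Chains r" "C \<subseteq> down y" "card C = k + 1"
    using Suc.hyps(1)[of y] y in_carrier by auto
  have below: "\<And>w. w \<in> C \<Longrightarrow> (w, x) \<in> r"
    using C(2) y(2) trans_r by (auto simp: down_def)
  have "x \<notin> C"
    using C(2) rank_mono[of x y] y(1) Suc.hyps(2) by (auto simp: down_def)
  moreover have "finite C" using C(1) by (rule finite_chain)
  ultimately have "card (insert x C) = \<rho> x + 1" using C(3) Suc.hyps(2) by simp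
  moreover have "insert x C \<in> Chains r" "insert x C \<subseteq> down x"
    using C(1) below refl_r[OF Suc.prems] by (auto simp: Chains_def down_def)
  ultimately show ?case by blast
qed

section \<open>Signed chain sums: link to the flag h-vector and recursion\<close>

text \<open>Chains with the same rank set carry the same sign; group them by that set.\<close>

lemma flag_h_eq_signed_chain_sum:
  assumes "finite S"
  shows "flag_h r \<rho> S = signed_chain_sum P S"
proof -
  let ?A = "{C. C \<in> Chains r \<and> C \<subseteq> P \<and> \<rho> ` C \<subseteq> S}"
  have "finite ?A" using finite_Chains by simp
  then have "signed_chain_sum P S =
      (\<Sum>T \<in> Pow S. \<Sum>C \<in> {C \<in> ?A. \<rho> ` C = T}. (-1) ^ card (S - \<rho> ` C))"
    unfolding signed_chain_sum_def using assms by (intro sum.group[symmetric]) auto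
  also have "\<dots> = flag_h r \<rho> S"
    unfolding flag_h_def flag_f_def
  proof (rule sum.cong)
    fix T assume "T \<in> Pow S"
    then have "{C \<in> ?A. \<rho> ` C = T} = {C \<in> Chains r. \<rho> ` C = T}"
      using Chains_subset by auto
    then show "(\<Sum>C \<in> {C \<in> ?A. \<rho> ` C = T}. (-1) ^ card (S - \<rho> ` C)) =
        (-1) ^ card (S - T) * int (card {C \<in> Chains r. \<rho> ` C = T})"
      by simp
  qed simp
  finally show ?thesis by simp
qed

lemma signed_chain_sum_empty: "signed_chain_sum Q {} = 1"
proof -
  have "{C. C \<in> Chains r \<and> C \<subseteq> Q \<and> \<rho> ` C \<subseteq> {}} = {{}}"
    by (auto simp: Chains_def)
  then show ?thesis by (simp add: signed_chain_sum_def)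
qed

lemma signed_chain_sum_cong:
  assumes "\<And>z. z \<in> P \<Longrightarrow> \<rho> z \<in> S \<Longrightarrow> z \<in> Q \<longleftrightarrow> z \<in> Q'"
  shows "signed_chain_sum Q S = signed_chain_sum Q' S"
proof -
  have "C \<subseteq> Q \<longleftrightarrow> C \<subseteq> Q'" if "C \<in> Chains r" "\<rho> ` C \<subseteq> S" for C
    using assms Chains_subset[OF that(1)] that(2) by blast
  then have "{C. C \<in> Chains r \<and> C \<subseteq> Q \<and> \<rho> ` C \<subseteq> S} = {C. C \<in> Chains r \<and> C \<subseteq> Q' \<and> \<rho> ` C \<subseteq> S}"
    by blast
  then show ?thesis by (simp add: signed_chain_sum_def)
qed

text \<open>A chain avoiding rank \<open>m\<close> has one more missing rank, hence the minus sign.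
  Any other chain is an element \<open>y\<close> of rank \<open>m\<close> on top of a chain in
  \<open>down y\<close>, with the same missing ranks as before. Conversely such chains stay in
  \<open>Q\<close> because \<open>Q\<close> is closed downwards.\<close>

lemma signed_chain_sum_insert_max:
  assumes "finite S" "\<And>s. s \<in> S \<Longrightarrow> s < m"
    and Q: "Q \<subseteq> P" "\<And>x. x \<in> Q \<Longrightarrow> down x \<subseteq> Q"
  shows "signed_chain_sum Q (insert m S) =
    (\<Sum>y \<in> {y \<in> Q. \<rho> y = m}. signed_chain_sum (down y) S) - signed_chain_sum Q S"
proof -
  define A where "A Q = {C. C \<in> Chains r \<and> C \<subseteq> Q \<and> \<rho> ` C \<subseteq> S}" for Q
  define L where "L = {y \<in> Q. \<rho> y = m}"
  let ?f = "\<lambda>C. (-1) ^ card (insert m S - \<rho> ` C) :: int"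
  let ?ins = "\<lambda>(y, C). insert y C"
  have finA: "finite (A Q)" for Q using finite_Chains by (simp add: A_def)
  have finL: "finite L" using finite_subset[OF Q(1) finite_carrier] by (simp add: L_def)
  have mS: "m \<notin> S" using assms(2) by blast
  have split: "{C. C \<in> Chains r \<and> C \<subseteq> Q \<and> \<rho> ` C \<subseteq> insert m S} =
      A Q \<union> ?ins ` (SIGMA y:L. A (down y))" (is "?B = _")
  proof (intro equalityI subsetI)
    fix C assume C: "C \<in> ?B"
    show "C \<in> A Q \<union> ?ins ` (SIGMA y:L. A (down y))"
    proof (cases "m \<in> \<rho> ` C")
      case False
      then show ?thesis using C by (auto simp: A_def)
    next
      case True
      then obtain y where y: "y \<in> C" "\<rho> y = m" by blast
      \<comment> \<open>Since \<open>m\<close> is the largest rank allowed, nothing in the chain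
        lies strictly above \<open>y\<close>.\<close>
      have below: "(z, y) \<in> r \<and> \<rho> z \<in> S" if z: "z \<in> C - {y}" for z
      proof -
        have "\<rho> z \<le> m" using C z assms(2) by fastforce
        then have "\<not> ((y, z) \<in> r)" using rank_strict_mono[of y z] z y(2) by auto
        then have zy: "(z, y) \<in> r" using C z y(1) by (auto simp: Chains_def)
        then have "\<rho> z < m" using rank_strict_mono[of z y] z y(2) by auto
        then show ?thesis using zy C z by auto
      qed
      have "C - {y} \<in> A (down y)"
        using C below by (auto simp: A_def down_def Chains_def)
      moreover have "y \<in> L" using y C by (auto simp: L_def)
      moreover have "C = ?ins (y, C - {y})" using y by auto
      ultimately show ?thesis by (intro UnI2 image_eqI[where x = "(y, C - {y})"]) simp_all
    qed
  next
    fix C assume "C \<in> A Q \<union> ?ins ` (SIGMA y:L. A (down y))"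
    then consider "C \<in> A Q" | y D where "y \<in> L" "D \<in> A (down y)" "C = insert y D" by auto
    then show "C \<in> ?B"
    proof cases
      case 1
      then show ?thesis by (auto simp: A_def)
    next
      case 2
      then have "y \<in> Q" "\<rho> y = m" "y \<in> P" "D \<subseteq> down y" "D \<in> Chains r" "\<rho> ` D \<subseteq> S"
        using Q(1) by (auto simp: A_def L_def)
      moreover have "insert y D \<in> Chains r"
        using calculation refl_r by (auto simp: Chains_def down_def)
      ultimately show ?thesis using Q(2) 2(3) by auto
    qed
  qed
  have disj: "A Q \<inter> ?ins ` (SIGMA y:L. A (down y)) = {}"
    using mS by (auto simp: A_def L_def)
  have inj: "inj_on ?ins (SIGMA y:L. A (down y))"
  proof (rule inj_onI)
    fix p q assume p: "p \<in> (SIGMA y:L. A (down y))" and q: "q \<in> (SIGMA y:L. A (down y))"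
      and eq: "?ins p = ?ins q"
    \<comment> \<open>The pair can be read off its union: rank \<open>m\<close> gives
      \<open>y\<close>, the other ranks give the chain.\<close>
    have top: "{z \<in> ?ins p. \<rho> z = m} = {fst p} \<and> {z \<in> ?ins p. \<rho> z \<noteq> m} = snd p"
      if pair: "p \<in> (SIGMA y:L. A (down y))" for p
    proof -
      obtain y C where "p = (y, C)" "\<rho> y = m" "\<forall>z \<in> C. \<rho> z \<in> S"
        using pair by (auto simp: A_def L_def image_subset_iff)
      moreover from this have "\<forall>z \<in> C. \<rho> z \<noteq> m" using mS by metis
      ultimately show ?thesis by auto
    qed
    have "{fst p} = {fst q}" "snd p = snd q"
      using top[OF p] top[OF q] unfolding eq by auto
    then show "p = q" by (simp add: prod_eq_iff)
  qed
  have "signed_chain_sum Q (insert m S) =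
      sum ?f (A Q) + sum ?f (?ins ` (SIGMA y:L. A (down y)))"
    unfolding signed_chain_sum_def split
    using finA finL disj by (intro sum.union_disjoint) auto
  also have "sum ?f (A Q) = - signed_chain_sum Q S"
    unfolding signed_chain_sum_def A_def[symmetric] sum_negf[symmetric]
  proof (rule sum.cong)
    fix C assume "C \<in> A Q"
    then have "insert m S - \<rho> ` C = insert m (S - \<rho> ` C)" using mS by (auto simp: A_def)
    then show "?f C = - ((-1) ^ card (S - \<rho> ` C))" using mS assms(1) by simp
  qed simp
  also have "sum ?f (?ins ` (SIGMA y:L. A (down y))) = (\<Sum>(y, C) \<in> (SIGMA y:L. A (down y)). ?f (insert y C))"
    using inj by (subst sum.reindex) (auto simp: case_prod_unfold)
  also have "\<dots> = (\<Sum>y \<in> L. \<Sum>C \<in> A (down y). ?f (insert y C))"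
    using finL finA by (subst sum.Sigma) auto
  also have "\<dots> = (\<Sum>y \<in> L. signed_chain_sum (down y) S)"
    unfolding signed_chain_sum_def A_def[symmetric]
  proof (intro sum.cong refl)
    fix y C assume "y \<in> L" "C \<in> A (down y)"
    then have "insert m S - \<rho> ` insert y C = S - \<rho> ` C" using mS by (auto simp: L_def)
    then show "?f (insert y C) = (-1) ^ card (S - \<rho> ` C)" by simp
  qed
  finally show ?thesis by (simp add: L_def)
qed

section \<open>At most two elements of each rank force values 0, 1 and -1\<close>

text \<open>The two claims share one induction: the recursion for \<open>P\<close> needs the values
  at \<open>down y\<close> for \<open>y\<close> of rank \<open>m\<close>, and these elements do have
  rank above the smaller set.\<close>

lemma signed_chain_sum_down_cases:
  assumes bot: "b \<in> P" "\<And>t. t \<in> P \<Longrightarrow> (b, t) \<in> r"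
    and top: "u \<in> P" "\<And>t. t \<in> P \<Longrightarrow> (t, u) \<in> r"
    and two: "\<And>i. card {t \<in> P. \<rho> t = i} \<le> 2"
    and "finite S"
  shows "signed_chain_sum P S \<in> {0, 1, -1} \<and>
    (\<forall>x \<in> P. (\<forall>s \<in> S. s < \<rho> x) \<longrightarrow> signed_chain_sum (down x) S \<in> {0, signed_chain_sum P S})"
  using \<open>finite S\<close>
proof (induction S rule: finite_linorder_max_induct)
  case empty
  then show ?case by (simp add: signed_chain_sum_empty)
next
  case (insert m S)
  define L where "L = {y \<in> P. \<rho> y = m}"
  let ?b = "signed_chain_sum P S"
  have rank_bot: "\<rho> b = 0"
    using rank_function bot in_carrier antisym_r unfolding rank_function_def by blast
  have finL: "finite L" using finite_carrier by (simp add: L_def)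
  have cardL: "card L \<le> 2" using two by (simp add: L_def)
  have IHL: "signed_chain_sum (down y) S \<in> {0, ?b}" if "y \<in> L" for y
    using insert that by (auto simp: L_def)
  have P_rec: "signed_chain_sum P (insert m S) = (\<Sum>y \<in> L. signed_chain_sum (down y) S) - ?b"
    using signed_chain_sum_insert_max[of S m P] insert.hyps down_subset by (simp add: L_def)
  have "card L = 0 \<or> card L = 1 \<or> card L = 2" using cardL by linarith
  then consider "L = {}" | y where "L = {y}" | y z where "L = {y, z}" "y \<noteq> z"
    using finL by (auto simp: card_1_singleton_iff card_2_iff)
  \<comment> \<open>At most two summands, each 0 or \<open>?b\<close>, add up to 0,
    \<open>?b\<close> or twice \<open>?b\<close>; subtracting \<open>?b\<close> leaves at most a
    change of sign.\<close>
  then have "signed_chain_sum P (insert m S) \<in> {0, 1, -1}"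
  proof cases
    case 1
    then show ?thesis using P_rec insert.IH by auto
  next
    case (2 y)
    then show ?thesis using P_rec IHL[of y] insert.IH by auto
  next
    case (3 y z)
    then show ?thesis using P_rec IHL[of y] IHL[of z] insert.IH by auto
  qed
  moreover have "signed_chain_sum (down x) (insert m S) \<in> {0, signed_chain_sum P (insert m S)}"
    if x: "x \<in> P" "\<forall>s \<in> insert m S. s < \<rho> x" for x
  proof -
    define K where "K = {y \<in> down x. \<rho> y = m}"
    have KL: "K \<subseteq> L" using down_subset by (auto simp: K_def L_def)
    have x_rec: "signed_chain_sum (down x) (insert m S) =
        (\<Sum>y \<in> K. signed_chain_sum (down y) S) - signed_chain_sum (down x) S"
      using signed_chain_sum_insert_max[of S m "down x"] insert.hyps down_subset trans_r
      by (fastforce simp: K_def down_def)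
    have through: "\<exists>y \<in> K. (z, y) \<in> r" if "z \<in> down x" "\<rho> z \<in> S" for z
      using rank_interpolation[of z x m] that insert.hyps(2) x(2)
      by (force simp: K_def down_def)
    show ?thesis
    proof (cases "K = L")
      case True
      \<comment> \<open>Interpolation towards the top puts \<open>z\<close> below an element of rank
        \<open>m\<close>, and all of these lie below \<open>x\<close>. Hence both recursions have
        the same right-hand side.\<close>
      have "z \<in> down x" if z: "z \<in> P" "\<rho> z \<in> S" for z
      proof -
        have "\<rho> z \<le> m" "m \<le> \<rho> u"
          using insert.hyps(2) z rank_mono[OF top(2)[OF x(1)]] x(2) by force+
        then obtain y where y: "\<rho> y = m" "(z, y) \<in> r"
          using rank_interpolation[OF top(2)[OF z(1)]] by blast
        then have "y \<in> K" using True in_carrier by (auto simp: L_def)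
        then show ?thesis using y trans_r by (auto simp: K_def down_def)
      qed
      then have "signed_chain_sum (down x) S = ?b"
        using down_subset by (intro signed_chain_sum_cong) auto
      then show ?thesis using x_rec P_rec True by simp
    next
      case False
      \<comment> \<open>The bottom has rank 0 and \<open>m\<close> is less than the rank of
        \<open>x\<close>, so some element of rank \<open>m\<close> lies between them. As
        \<open>K\<close> is a proper subset of \<open>L\<close>, it then has exactly one
        element.\<close>
      obtain y0 where "\<rho> y0 = m" "(y0, x) \<in> r"
        using rank_interpolation[OF bot(2)[OF x(1)], of m] rank_bot x(2) by auto
      then have "K \<noteq> {}" by (auto simp: K_def down_def)
      then have "card K > 0" using KL finL finite_subset card_gt_0_iff by metis
      moreover have "card K < card L" using KL False finL by (simp add: psubset_card_mono psubsetI)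
      ultimately have "card K = 1" using cardL by simp
      then obtain y where y: "K = {y}" by (rule card_1_singletonE)
      then have yx: "(y, x) \<in> r" by (auto simp: K_def down_def)
      \<comment> \<open>Every element below \<open>x\<close> with rank in \<open>S\<close> passes
        through the only \<open>y\<close> in \<open>K\<close>, so the two terms of the recursion
        cancel.\<close>
      have "signed_chain_sum (down x) S = signed_chain_sum (down y) S"
        using through y yx trans_r by (intro signed_chain_sum_cong) (auto simp: down_def)
      then show ?thesis using x_rec y by simp
    qed
  qed
  ultimately show ?case by blast
qed

end

section \<open>Ranks outside \<open>{1..<n}\<close>, and the two implications\<close>

theorem theorem4p1:
  fixes P :: "'a set" and r :: "('a \<times> 'a) set" and n :: nat and \<rho> :: "'a \<Rightarrow> nat"
  assumes "finite_graded_poset P r n"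
    and "has_bot_top P r"
    and "rank_function P r \<rho>"
  shows "multiplicity_free n (flag_h r \<rho>) \<longleftrightarrow> (\<forall>i. card {t \<in> P. \<rho> t = i} \<le> 2)"
proof -
  interpret ranked_poset P r \<rho>
    using assms by unfold_locales (auto simp: finite_graded_poset_def)
  obtain b u where b: "b \<in> P" "\<And>t. t \<in> P \<Longrightarrow> (b, t) \<in> r" and u: "u \<in> P" "\<And>t. t \<in> P \<Longrightarrow> (t, u) \<in> r"
    using assms(2) by (auto simp: has_bot_top_def)
  \<comment> \<open>A chain with one element more than the rank of \<open>u\<close> extends to a
    maximal chain, which has \<open>n + 1\<close> elements.\<close>
  have rank_u: "\<rho> u \<le> n"
  proof -
    obtain C where C: "C \<in> Chains r" "card C = \<rho> u + 1"
      using exists_chain_of_rank[OF u(1)] by blast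
    obtain D where D: "D \<in> maximal_chains r" "C \<subseteq> D"
      using chain_extends_to_maximal[OF finite_carrier partial_order C(1)] .
    have "finite D"
      using D(1) finite_chain by (auto simp: maximal_chains_def)
    moreover have "card D = n + 1" using D(1) assms(1) by (auto simp: finite_graded_poset_def)
    ultimately show ?thesis using C(2) card_mono[OF _ D(2)] by simp
  qed
  \<comment> \<open>Multiplicity-freeness says nothing about these ranks. Only the bottom has rank
    0, and only the top can have rank \<open>n\<close> or more.\<close>
  have extreme_ranks: "card {t \<in> P. \<rho> t = i} \<le> 2" if "i \<notin> {1..<n}" for i
  proof -
    have "t = (if i = 0 then b else u)" if t: "t \<in> P" "\<rho> t = i" for t
      using rank_strict_mono[OF b(2)[OF t(1)]] rank_strict_mono[OF u(2)[OF t(1)]] t rank_u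
        \<open>i \<notin> {1..<n}\<close> by (cases "i = 0") auto
    then have "{t \<in> P. \<rho> t = i} \<subseteq> {if i = 0 then b else u}" by auto
    from card_mono[OF _ this] show ?thesis by simp
  qed
  show ?thesis
  proof
    assume mf: "multiplicity_free n (flag_h r \<rho>)"
    show "\<forall>i. card {t \<in> P. \<rho> t = i} \<le> 2"
    proof
      fix i
      show "card {t \<in> P. \<rho> t = i} \<le> 2"
      proof (cases "i \<in> {1..<n}")
        case False
        then show ?thesis by (rule extreme_ranks)
      next
        case True
        then have "flag_h r \<rho> {i} \<in> {0, 1, -1}" using mf by (auto simp: multiplicity_free_def)
        moreover have "flag_h r \<rho> {i} = int (card {t \<in> P. \<rho> t = i}) - 1"
          using flag_h_eq_signed_chain_sum[of "{i}"] signed_chain_sum_insert_max[of "{}" i P]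
            down_subset by (simp add: signed_chain_sum_empty)
        ultimately show ?thesis by auto
      qed
    qed
  next
    assume "\<forall>i. card {t \<in> P. \<rho> t = i} \<le> 2"
    then have "flag_h r \<rho> S \<in> {0, 1, -1}" if "finite S" for S
      using signed_chain_sum_down_cases[OF b u _ that] flag_h_eq_signed_chain_sum[OF that] by simp
    then show "multiplicity_free n (flag_h r \<rho>)"
      unfolding multiplicity_free_def using finite_subset[OF _ finite_atLeastLessThan] by blast
  qed
qed

end
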